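(* Let $\boldsymbol{\Phi}:\Lambda_M\times\Lambda_M\to\mathbb{R}$ be the kernel $\boldsymbol{\Phi}_{m;n}:=\Phi_{\xi_m}(n)$ ($m,n\in\Lambda_M$). (i) The functions $\boldsymbol{\Phi}_{m;\cdot}:\Lambda_M\to\mathbb{R}$, $m\in\Lambda_M$, form an orthogonal basis of $l^2(\Lambda_M,\Delta)$, viz. for any $m,m'\in\Lambda_M$ $$\langle\boldsymbol{\Phi}_{m;\cdot},\boldsymbol{\Phi}_{m';\cdot}\rangle_\Delta=\sum_{n=0}^M\boldsymbol{\Phi}_{m;n}\boldsymbol{\Phi}_{m';n}\Delta_n=\begin{cases}0&\text{if }m\neq m',\\ \hat{\Delta}_m^{-1}&\text{if }m=m'.\end{cases}$$ (ii) The functions $\boldsymbol{\Phi}_{\cdot;n}:\Lambda_M\to\mathbb{R}$, $n\in\Lambda_M$, form an orthogonal basis of $l^2(\Lambda_M,\hat{\Delta})$, viz. for any $n,n'\in\Lambda_M$ $$\langle\boldsymbol{\Phi}_{\cdot;n},\boldsymbol{\Phi}_{\cdot;n'}\rangle_{\hat{\Delta}}=\sum_{m=0}^M\boldsymbol{\Phi}_{m;n}\boldsymbol{\Phi}_{m;n'}\hat{\Delta}_m=\begin{cases}0&\text{if }n\neq n',\\ \Delta_n^{-1}&\text{if }n=n'.\end{cases}$$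
   Context: Fix $\tau\in(0,1)$ and an integer $M>1$; $\Lambda_M:=\{0,1,\dots,M\}$. Spectral values: $V(\xi):=M\xi+\theta(\xi)$ with $\theta(\xi):=(1-\tau^4)\int_0^{2\xi}\frac{dx}{1+\tau^4-2\tau^2\cos x}$; for $m\in\Lambda_M$, $\xi_m$ is the unique real solution of $V(\xi)=(m+1)\pi$; it lies in $(0,\pi)$. Spherical function: $\mathcal{C}(\mathbb{Z})$ is the space of functions $f:\mathbb{Z}\to\mathbb{C}$, $f_n:=f(n)$. Let $(sf)_n=f_{-n}$, $(uf)_n=f_{M-n}$, and $I:=\tau s+(\tau-\tau^{-1})J$, where $(Jf)_n:=-f_{n-2}-f_{n-4}-\dots-f_{-n}$ if $n>0$, $(Jf)_0:=0$, $(Jf)_n:=f_n+f_{n+2}+\dots+f_{-n-2}$ if $n<0$ (steps of $2$, $|n|$ terms). Let $W=\langle s,u\mid s^2=u^2=1\rangle$ act on $\mathbb{Z}$ by $sn=-n$, $un=M-n$; $s_1:=s$, $s_0:=usu$, $W_S:=\langle s_0,s_1\rangle$ with length function $\ell$ with respect to $s_0,s_1$. Let $w_n$ be the unique shortest element of $W_S$ with $n_+:=w_nn\in\Lambda_M$. For a reduced expression $w=s_{i_1}\cdots s_{i_r}\in W_S$ put $I_w:=I_{s_{i_1}}\cdots I_{s_{i_r}}$ with $I_{s_1}:=I$, $I_{s_0}:=uIu$, and let $(\mathcal{J}f)_n:=\tau^{-\ell(w_n)}(I_{w_n}f)_{n_+}$. For $\xi\in\mathbb{R}$, $\Phi_\xi:=\mathcal{J}\phi_\xi$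 with $\phi_\xi:=(1+\tau I)\mathbf{e}^{i\xi}$, where $\mathbf{e}^{i\xi}(n):=e^{i\xi n}$. In particular, for $m,n\in\Lambda_M$, $$\Phi_{\xi_m}(n)=c(\xi_m)e^{i\xi_mn}+c(-\xi_m)e^{-i\xi_mn},\qquad c(\xi):=\frac{1-\tau^2e^{-2i\xi}}{1-e^{-2i\xi}},$$ which is real. Inner products on functions $f,g:\Lambda_M\to\mathbb{C}$: $l^2(\Lambda_M,\Delta)$ has $\langle f,g\rangle_\Delta:=\sum_{n\in\Lambda_M}f_n\overline{g_n}\Delta_n$ with $\Delta_0=\Delta_M=(1+\tau^2)^{-1}$ and $\Delta_n=1$ for $0<n<M$. $l^2(\Lambda_M,\hat\Delta)$ has $\langle f,g\rangle_{\hat\Delta}:=\sum_{m\in\Lambda_M}f_m\overline{g_m}\hat\Delta_m$ with $$\hat\Delta_m:=\frac{1}{2c(\xi_m)c(-\xi_m)V'(\xi_m)}=\frac{1-\cos(2\xi_m)}{1+\tau^4-2\tau^2\cos(2\xi_m)}\Bigl(M+\frac{2(1-\tau^4)}{1+\tau^4-2\tau^2\cos(2\xi_m)}\Bigr)^{-1}.$$ *)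

theory Defs
  imports "HOL-Analysis.Analysis" "HOL-Library.Function_Algebras"
begin

text \<open>The group \<open>W = \<langle>s, u | s\<^sup>2 = u\<^sup>2 = 1\<rangle>\<close>: words in the two generators, modulo the congruence generated by deleting a
  subword \<open>a a\<close>. The relations make every generator its own inverse, so no formal
  inverses are needed in the words.\<close>

datatype gen = S | U

definition cancels :: "gen list \<Rightarrow> gen list \<Rightarrow> bool" where
  "cancels v w \<longleftrightarrow> (\<exists>x a y. v = x @ [a, a] @ y \<and> w = x @ y)"

lemma equivclp_cong:
  assumes "equivclp r x y" "\<And>a b. r a b \<Longrightarrow> equivclp q (f a) (f b)"
  shows "equivclp q (f x) (f y)"
  using assms(1)
proof (induction rule: equivclp_induct)
  case base
  then show ?case by simp
next
  case (step y z)
  then have "equivclp q (f y) (f z)"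
    using assms(2) equivclp_sym by metis
  with step show ?case by (meson equivclp_trans)
qed

lemma equivclp_cancels_append:
  assumes "equivclp cancels v v'" "equivclp cancels w w'"
  shows "equivclp cancels (v @ w) (v' @ w')"
proof -
  have "equivclp cancels (a @ w) (b @ w)" if "cancels a b" for a b
    by (rule r_into_equivclp) (use that in \<open>force simp: cancels_def\<close>)
  then have 1: "equivclp cancels (v @ w) (v' @ w)"
    by (rule equivclp_cong[OF assms(1), where f = "\<lambda>x. x @ w"])
  have "equivclp cancels (v' @ a) (v' @ b)" if "cancels a b" for a b
    by (rule r_into_equivclp) (use that in \<open>auto simp: cancels_def\<close>, metis append.assoc)
  then have 2: "equivclp cancels (v' @ w) (v' @ w')"
    by (rule equivclp_cong[OF assms(2), where f = "\<lambda>x. v' @ x"])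
  from 1 2 show ?thesis by (rule equivclp_trans)
qed

quotient_type dihedral = "gen list" / "equivclp cancels"
  by simp

instantiation dihedral :: monoid_mult
begin

lift_definition one_dihedral :: dihedral is "[]" .

lift_definition times_dihedral :: "dihedral \<Rightarrow> dihedral \<Rightarrow> dihedral" is "(@)"
  by (rule equivclp_cancels_append)

instance
  by standard (transfer; simp)+

end

lift_definition gen_s :: dihedral is "[S]" .
lift_definition gen_u :: dihedral is "[U]" .

lemma gen_s_square: "gen_s * gen_s = 1" and gen_u_square: "gen_u * gen_u = 1"
  by (transfer, rule r_into_equivclp, force simp: cancels_def)+

primrec gen_act :: "int \<Rightarrow> gen \<Rightarrow> int \<Rightarrow> int" where
  "gen_act M S n = - n"
| "gen_act M U n = M - n"

lift_definition act :: "int \<Rightarrow> dihedral \<Rightarrow> int \<Rightarrow> int" is "\<lambda>M. foldr (gen_act M)"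
proof -
  fix M v w
  assume "equivclp cancels v w"
  moreover have "gen_act M a (gen_act M a n) = n" for a n
    by (cases a) auto
  ultimately show "foldr (gen_act M) v = foldr (gen_act M) w"
    by (induction rule: equivclp_induct) (force simp: cancels_def fun_eq_iff)+
qed

text \<open>Indices 0 and 1 stand for \<open>s\<^sub>0 = u s u\<close> and \<open>s\<^sub>1 = s\<close>.\<close>

definition refl_gen :: "nat \<Rightarrow> dihedral" where
  "refl_gen i = (if i = 0 then gen_u * gen_s * gen_u else gen_s)"

definition expression_of :: "nat list \<Rightarrow> dihedral \<Rightarrow> bool" where
  "expression_of is w \<longleftrightarrow> set is \<subseteq> {0, 1} \<and> prod_list (map refl_gen is) = w"

text \<open>The generators are involutions, so the subgroup they generate is the set of
  their products.\<close>

definition W_S :: "dihedral set" where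
  "W_S = {w. \<exists>is. expression_of is w}"

definition ell :: "dihedral \<Rightarrow> nat" where
  "ell w = (LEAST r. \<exists>is. expression_of is w \<and> length is = r)"

definition reduced_expression :: "nat list \<Rightarrow> dihedral \<Rightarrow> bool" where
  "reduced_expression is w \<longleftrightarrow> expression_of is w \<and> length is = ell w"

abbreviation Lam :: "int \<Rightarrow> int set" where
  "Lam M \<equiv> {0..M}"

definition w_min :: "int \<Rightarrow> int \<Rightarrow> dihedral" where
  "w_min M n = (THE w. is_arg_min ell (\<lambda>w. w \<in> W_S \<and> act M w n \<in> Lam M) w)"

definition n_plus :: "int \<Rightarrow> int \<Rightarrow> int" where
  "n_plus M n = act M (w_min M n) n"

definition s_op :: "(int \<Rightarrow> complex) \<Rightarrow> int \<Rightarrow> complex" where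
  "s_op f n = f (- n)"

definition u_op :: "int \<Rightarrow> (int \<Rightarrow> complex) \<Rightarrow> int \<Rightarrow> complex" where
  "u_op M f n = f (M - n)"

definition J_op :: "(int \<Rightarrow> complex) \<Rightarrow> int \<Rightarrow> complex" where
  "J_op f n =
     (if n > 0 then - (\<Sum>k=1..nat n. f (n - 2 * int k))
      else if n = 0 then 0
      else (\<Sum>k<nat (- n). f (n + 2 * int k)))"

definition I_op :: "real \<Rightarrow> (int \<Rightarrow> complex) \<Rightarrow> int \<Rightarrow> complex" where
  "I_op \<tau> f n = of_real \<tau> * s_op f n + of_real (\<tau> - inverse \<tau>) * J_op f n"

definition I_gen :: "real \<Rightarrow> int \<Rightarrow> nat \<Rightarrow> (int \<Rightarrow> complex) \<Rightarrow> int \<Rightarrow> complex" where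
  "I_gen \<tau> M i = (if i = 0 then u_op M \<circ> I_op \<tau> \<circ> u_op M else I_op \<tau>)"

text \<open>\<open>W\<^sub>S\<close> is an infinite dihedral group, so each of its elements has exactly one
  reduced expression and the choice below is immaterial.\<close>

definition I_elt :: "real \<Rightarrow> int \<Rightarrow> dihedral \<Rightarrow> (int \<Rightarrow> complex) \<Rightarrow> int \<Rightarrow> complex" where
  "I_elt \<tau> M w = foldr (\<lambda>i F. I_gen \<tau> M i \<circ> F) (SOME is. reduced_expression is w) id"

definition intertwiner :: "real \<Rightarrow> int \<Rightarrow> (int \<Rightarrow> complex) \<Rightarrow> int \<Rightarrow> complex" where
  "intertwiner \<tau> M f n =
     of_real (inverse \<tau> ^ ell (w_min M n)) * I_elt \<tau> M (w_min M n) f (n_plus M n)"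

definition plane_wave :: "real \<Rightarrow> int \<Rightarrow> complex" where
  "plane_wave \<xi> n = exp (\<i> * of_real \<xi> * of_int n)"

definition phi :: "real \<Rightarrow> real \<Rightarrow> int \<Rightarrow> complex" where
  "phi \<tau> \<xi> n = plane_wave \<xi> n + of_real \<tau> * I_op \<tau> (plane_wave \<xi>) n"

definition Phi :: "real \<Rightarrow> int \<Rightarrow> real \<Rightarrow> int \<Rightarrow> complex" where
  "Phi \<tau> M \<xi> = intertwiner \<tau> M (phi \<tau> \<xi>)"

text \<open>The interval integral is oriented, as needed for \<open>\<xi> < 0\<close>.\<close>

definition theta :: "real \<Rightarrow> real \<Rightarrow> real" where
  "theta \<tau> \<xi> = (1 - \<tau>^4) * (LBINT x=0..2*\<xi>. 1 / (1 + \<tau>^4 - 2 * \<tau>\<^sup>2 * cos x))"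

definition V :: "real \<Rightarrow> int \<Rightarrow> real \<Rightarrow> real" where
  "V \<tau> M \<xi> = of_int M * \<xi> + theta \<tau> \<xi>"

definition xi :: "real \<Rightarrow> int \<Rightarrow> int \<Rightarrow> real" where
  "xi \<tau> M m = (THE \<xi>. V \<tau> M \<xi> = (of_int m + 1) * pi)"

lemma denominator_pos:
  fixes \<tau> x :: real
  assumes "0 < \<tau>" "\<tau> < 1"
  shows "1 + \<tau>^4 - 2 * \<tau>\<^sup>2 * cos x > 0"
proof -
  have "\<tau>\<^sup>2 < 1"
    using assms by (simp add: power_less_one_iff)
  then have "0 < (1 - \<tau>\<^sup>2)\<^sup>2"
    by simp
  also have "\<dots> = 1 + \<tau>^4 - 2 * \<tau>\<^sup>2"
    by (simp add: power2_eq_square algebra_simps power4_eq_xxxx)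
  also have "\<dots> \<le> 1 + \<tau>^4 - 2 * \<tau>\<^sup>2 * cos x"
    using mult_left_mono[OF cos_le_one[of x], of "2 * \<tau>\<^sup>2"] by simp
  finally show ?thesis .
qed

lemma V_has_real_derivative:
  assumes "0 < \<tau>" "\<tau> < 1"
  shows "(V \<tau> M has_real_derivative
           of_int M + 2 * (1 - \<tau>^4) / (1 + \<tau>^4 - 2 * \<tau>\<^sup>2 * cos (2 * \<xi>))) (at \<xi>)"
proof -
  let ?g = "\<lambda>x. 1 / (1 + \<tau>^4 - 2 * \<tau>\<^sup>2 * cos x)"
  let ?F = "\<lambda>u::real. LBINT x=ereal 0..ereal u. ?g x"
  define b where "b = \<bar>2 * \<xi>\<bar> + 1"
  have nz: "1 + \<tau>^4 - 2 * \<tau>\<^sup>2 * cos x \<noteq> 0" for x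
    using denominator_pos[OF assms, of x] by simp
  have "continuous_on {-b..b} ?g"
    by (intro continuous_intros ballI nz)
  then have "(?F has_vector_derivative ?g (2 * \<xi>)) (at (2 * \<xi>) within {-b..b})"
    by (intro interval_integral_FTC2) (auto simp: b_def)
  moreover have "at (2 * \<xi>) within {-b..b} = at (2 * \<xi>)"
    by (rule at_within_interior) (auto simp: b_def)
  ultimately have F: "(?F has_real_derivative ?g (2 * \<xi>)) (at (2 * \<xi>))"
    by (simp add: has_real_derivative_iff_has_vector_derivative)
  have 2: "((\<lambda>\<xi>. 2 * \<xi>) has_real_derivative 2) (at \<xi>)"
    by (auto intro!: derivative_eq_intros)
  have "((\<lambda>\<xi>. ?F (2 * \<xi>)) has_real_derivative ?g (2 * \<xi>) * 2) (at \<xi>)"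
    using DERIV_chain2[OF F 2] .
  then have "((\<lambda>\<xi>. of_int M * \<xi> + (1 - \<tau>^4) * ?F (2 * \<xi>)) has_real_derivative
      of_int M + (1 - \<tau>^4) * (?g (2 * \<xi>) * 2)) (at \<xi>)"
    by (auto intro!: derivative_eq_intros)
  moreover have "V \<tau> M = (\<lambda>\<xi>. of_int M * \<xi> + (1 - \<tau>^4) * ?F (2 * \<xi>))"
    by (simp add: fun_eq_iff V_def theta_def zero_ereal_def)
  ultimately show ?thesis
    by (simp add: mult.commute)
qed

lemma xi_ex1:
  assumes "0 < \<tau>" "\<tau> < 1" "M > 1" "m \<in> Lam M"
  shows "\<exists>!\<xi>. V \<tau> M \<xi> = (of_int m + 1) * pi"
proof -
  have t4: "0 < 1 - \<tau>^4"
    using assms by (simp add: power_less_one_iff)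
  let ?d = "\<lambda>x. of_int M + 2 * (1 - \<tau>^4) / (1 + \<tau>^4 - 2 * \<tau>\<^sup>2 * cos (2 * x))"
  have dM: "?d x > of_int M" for x
    using denominator_pos[OF assms(1,2), of "2 * x"] t4 by simp
  have d: "?d x > 0" for x
    using dM[of x] assms(3) by linarith
  have incr: "V \<tau> M x < V \<tau> M y" if "x < y" for x y
    by (rule DERIV_pos_imp_increasing[OF that])
       (use V_has_real_derivative[OF assms(1,2)] d in blast)
  have V0: "V \<tau> M 0 = 0"
    by (simp add: V_def theta_def zero_ereal_def[symmetric])
  define b where "b = (of_int m + 1) * pi / of_int M"
  have b: "b > 0"
    using assms by (auto simp: b_def intro!: divide_pos_pos mult_pos_pos)
  have W: "((\<lambda>x. V \<tau> M x - of_int M * x) has_real_derivative ?d x - of_int M) (at x)" for x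
    using V_has_real_derivative[OF assms(1,2), of M x] by (auto intro!: derivative_eq_intros)
  have "V \<tau> M 0 - of_int M * 0 < V \<tau> M b - of_int M * b"
  proof (rule DERIV_pos_imp_increasing[OF b])
    fix x
    have "?d x - of_int M > 0"
      using dM[of x] by simp
    with W[of x]
    show "\<exists>y. ((\<lambda>x. V \<tau> M x - of_int M * x) has_real_derivative y) (at x) \<and> 0 < y"
      by (intro exI conjI)
  qed
  then have Vb: "V \<tau> M b > (of_int m + 1) * pi"
    using assms(3) V0 by (simp add: b_def)
  have "continuous_on {0..b} (V \<tau> M)"
    using V_has_real_derivative[OF assms(1,2)]
    by (meson DERIV_isCont continuous_at_imp_continuous_on)
  moreover have "0 \<le> (of_int m + 1) * pi"
    using assms(4) by simp
  ultimately obtain x where "V \<tau> M x = (of_int m + 1) * pi"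
    using IVT'[of "V \<tau> M" 0 "(of_int m + 1) * pi" b] V0 Vb b by force
  then show ?thesis
    by (metis incr linorder_neq_iff)
qed

definition c_fun :: "real \<Rightarrow> real \<Rightarrow> complex" where
  "c_fun \<tau> \<xi> = (1 - of_real (\<tau>\<^sup>2) * exp (- 2 * \<i> * of_real \<xi>)) / (1 - exp (- 2 * \<i> * of_real \<xi>))"

definition Delta :: "real \<Rightarrow> int \<Rightarrow> int \<Rightarrow> real" where
  "Delta \<tau> M n = (if n = 0 \<or> n = M then inverse (1 + \<tau>\<^sup>2) else 1)"

text \<open>The real part only serves to give the weight a real type; see
  \<open>Delta_hat_complex\<close>.\<close>

definition Delta_hat :: "real \<Rightarrow> int \<Rightarrow> int \<Rightarrow> real" where
  "Delta_hat \<tau> M m =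
     Re (1 / (2 * c_fun \<tau> (xi \<tau> M m) * c_fun \<tau> (- xi \<tau> M m) *
              of_real (deriv (V \<tau> M) (xi \<tau> M m))))"

lemma c_fun_mult:
  "2 * c_fun \<tau> \<xi> * c_fun \<tau> (- \<xi>) =
     of_real ((1 + \<tau>^4 - 2 * \<tau>\<^sup>2 * cos (2 * \<xi>)) / (1 - cos (2 * \<xi>)))"
proof -
  define z where "z = exp (2 * \<i> * complex_of_real \<xi>)"
  have z0: "z \<noteq> 0" and iz: "exp (- 2 * \<i> * complex_of_real \<xi>) = inverse z"
    by (simp_all add: z_def exp_minus)
  have C: "complex_of_real (cos (2 * \<xi>)) = (z + inverse z) / 2"
    by (simp add: z_def cos_of_real[symmetric] cos_exp_eq exp_minus mult_ac)
  have 1: "c_fun \<tau> \<xi> = (1 - of_real (\<tau>\<^sup>2) * inverse z) / (1 - inverse z)"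
    unfolding c_fun_def iz ..
  have 2: "c_fun \<tau> (- \<xi>) = (1 - of_real (\<tau>\<^sup>2) * z) / (1 - z)"
    unfolding c_fun_def by (simp add: z_def)
  have N: "(1 - of_real (\<tau>\<^sup>2) * inverse z) * (1 - of_real (\<tau>\<^sup>2) * z) =
      complex_of_real (1 + \<tau>^4 - 2 * \<tau>\<^sup>2 * cos (2 * \<xi>))"
    unfolding of_real_diff of_real_add of_real_mult C
    using z0 by (simp add: field_simps power2_eq_square power4_eq_xxxx)
  have D: "(1 - inverse z) * (1 - z) = 2 * complex_of_real (1 - cos (2 * \<xi>))"
    unfolding of_real_diff C using z0 by (simp add: field_simps)
  have "2 * c_fun \<tau> \<xi> * c_fun \<tau> (- \<xi>) =
      2 * (((1 - of_real (\<tau>\<^sup>2) * inverse z) * (1 - of_real (\<tau>\<^sup>2) * z)) /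
           ((1 - inverse z) * (1 - z)))"
    unfolding 1 2 by simp
  also have "\<dots> = of_real ((1 + \<tau>^4 - 2 * \<tau>\<^sup>2 * cos (2 * \<xi>)) / (1 - cos (2 * \<xi>)))"
  proof -
    have "2 * (x / (2 * y)) = x / y" for x y :: complex
      by simp
    then show ?thesis
      unfolding N D of_real_divide .
  qed
  finally show ?thesis .
qed

lemma Delta_hat_complex:
  "complex_of_real (Delta_hat \<tau> M m) =
     1 / (2 * c_fun \<tau> (xi \<tau> M m) * c_fun \<tau> (- xi \<tau> M m) *
          of_real (deriv (V \<tau> M) (xi \<tau> M m)))"
  unfolding Delta_hat_def c_fun_mult
  unfolding of_real_mult[symmetric] of_real_1[symmetric, where 'a = complex] of_real_divide[symmetric]
  by simp

lemma Delta_hat_eq: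
  fixes \<tau> :: real
  assumes "0 < \<tau>" "\<tau> < 1"
  defines "D \<equiv> (\<lambda>\<xi>. 1 + \<tau>^4 - 2 * \<tau>\<^sup>2 * cos (2 * \<xi>))"
  shows "Delta_hat \<tau> M m =
     (1 - cos (2 * xi \<tau> M m)) / D (xi \<tau> M m) *
     inverse (of_int M + 2 * (1 - \<tau>^4) / D (xi \<tau> M m))"
proof -
  have "deriv (V \<tau> M) (xi \<tau> M m) = of_int M + 2 * (1 - \<tau>^4) / D (xi \<tau> M m)"
    unfolding D_def by (rule DERIV_imp_deriv[OF V_has_real_derivative[OF assms(1,2)]])
  then have "complex_of_real (Delta_hat \<tau> M m) =
      complex_of_real ((1 - cos (2 * xi \<tau> M m)) / D (xi \<tau> M m) *
       inverse (of_int M + 2 * (1 - \<tau>^4) / D (xi \<tau> M m)))"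
    unfolding Delta_hat_complex c_fun_mult D_def by (simp add: field_simps)
  then show ?thesis
    by (simp only: of_real_eq_iff)
qed

text \<open>A function \<open>\<Lambda>\<^sub>M \<rightarrow> \<complex>\<close> is represented by its extension by zero to the integers.\<close>

definition Lam_functions :: "int \<Rightarrow> (int \<Rightarrow> complex) set" where
  "Lam_functions M = {f. \<forall>n. n \<notin> Lam M \<longrightarrow> f n = 0}"

definition cfun_scale :: "complex \<Rightarrow> (int \<Rightarrow> complex) \<Rightarrow> int \<Rightarrow> complex" where
  "cfun_scale a f = (\<lambda>n. a * f n)"

global_interpretation cfun: vector_space cfun_scale
  by unfold_locales (auto simp: cfun_scale_def fun_eq_iff algebra_simps)

definition inner_l2 :: "int \<Rightarrow> (int \<Rightarrow> real) \<Rightarrow> (int \<Rightarrow> complex) \<Rightarrow> (int \<Rightarrow> complex) \<Rightarrow> complex" where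
  "inner_l2 M w f g = (\<Sum>n\<in>Lam M. f n * cnj (g n) * of_real (w n))"

definition orthogonal_basis :: "int \<Rightarrow> (int \<Rightarrow> real) \<Rightarrow> (int \<Rightarrow> int \<Rightarrow> complex) \<Rightarrow> bool" where
  "orthogonal_basis M w F \<longleftrightarrow>
     inj_on F (Lam M) \<and>
     cfun.independent (F ` Lam M) \<and>
     cfun.span (F ` Lam M) = Lam_functions M \<and>
     (\<forall>i\<in>Lam M. \<forall>j\<in>Lam M. i \<noteq> j \<longrightarrow> inner_l2 M w (F i) (F j) = 0)"

definition Phi_kernel :: "real \<Rightarrow> int \<Rightarrow> int \<Rightarrow> int \<Rightarrow> complex" where
  "Phi_kernel \<tau> M m n = (if m \<in> Lam M \<and> n \<in> Lam M then Phi \<tau> M (xi \<tau> M m) n else 0)"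

end

theory Submission
  imports Defs
begin

text \<open>On \<open>\<Lambda>\<^sub>M\<close> the intertwiner acts trivially, so \<open>\<Phi>\<^sub>\<xi>(n) sin \<xi> = sin ((n + 1) \<xi>) - \<tau>\<^sup>2 sin ((n - 1) \<xi>)\<close>.
  These functions satisfy a three-term recurrence with eigenvalue \<open>2 cos \<xi>\<close>, and the quantization
  condition \<open>V(\<xi>\<^sub>m) = (m + 1) \<pi>\<close> makes them symmetric or antisymmetric under \<open>n \<mapsto> M - n\<close>, hence
  eigenvectors of a Jacobi matrix that is symmetric with respect to \<open>\<Delta>\<close>. The eigenvalues
  \<open>2 cos \<xi>\<^sub>m\<close> are distinct, which gives orthogonality. In polar form \<open>\<Phi>\<^sub>\<xi>(n)\<close> is proportional to
  \<open>sin ((n + 1) \<xi> + a)\<close>, so the norms reduce to a telescoping sum of cosines. Since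
  the system has \<open>M + 1\<close> members, the dual relations follow by expanding indicator functions.\<close>

section \<open>The intertwiner is trivial on \<Lambda>\<close>

lemma ell_1: "ell 1 = 0"
proof -
  have "expression_of [] 1"
    by (simp add: expression_of_def)
  then show ?thesis
    unfolding ell_def by (intro Least_eq_0) blast
qed

lemma ell_0_imp:
  assumes "w \<in> W_S" "ell w = 0"
  shows "w = 1"
proof -
  have "\<exists>r is. expression_of is w \<and> length is = r"
    using assms(1) by (auto simp: W_S_def)
  then have "\<exists>is. expression_of is w \<and> length is = ell w"
    unfolding ell_def by (rule LeastI_ex)
  then show ?thesis
    using assms(2) by (auto simp: expression_of_def)
qed

lemma one_in_W_S: "1 \<in> W_S"
proof -
  have "expression_of [] 1"
    by (simp add: expression_of_def)
  then show ?thesis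
    unfolding W_S_def by blast
qed

lemma act_1: "act M 1 n = n"
  by transfer simp

text \<open>The identity is admissible and is the only element of \<open>W_S\<close> of length 0.
  Hence every minimiser equals it, so the definite description in \<open>w_min\<close> is well
  defined here.\<close>

lemma w_min_Lam:
  assumes "n \<in> Lam M"
  shows "w_min M n = 1"
  unfolding w_min_def
proof (rule the_equality)
  have one: "1 \<in> W_S \<and> act M 1 n \<in> Lam M"
    using assms by (simp add: one_in_W_S act_1)
  then show "is_arg_min ell (\<lambda>w. w \<in> W_S \<and> act M w n \<in> Lam M) 1"
    by (simp add: is_arg_min_def ell_1)
  show "w = 1" if "is_arg_min ell (\<lambda>w. w \<in> W_S \<and> act M w n \<in> Lam M) w" for w
    using that one ell_0_imp[of w] ell_1 unfolding is_arg_min_def by (metis gr0I)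
qed

lemma I_elt_1: "I_elt \<tau> M 1 = id"
proof -
  \<comment> \<open>The length condition leaves only the empty word, so the choice made by
    \<open>SOME\<close> is forced and the fold collapses to \<open>id\<close>.\<close>
  have "reduced_expression is 1 \<longleftrightarrow> is = []" for "is"
    by (auto simp: reduced_expression_def ell_1 expression_of_def)
  then show ?thesis
    by (simp add: I_elt_def)
qed

lemma Phi_Lam:
  assumes "n \<in> Lam M"
  shows "Phi \<tau> M \<xi> n = phi \<tau> \<xi> n"
  using assms by (simp add: Phi_def intertwiner_def w_min_Lam n_plus_def act_1 I_elt_1 ell_1)

section \<open>Closed form of the spherical function\<close>

definition spherical :: "real \<Rightarrow> real \<Rightarrow> int \<Rightarrow> real" where
  "spherical \<tau> \<xi> n = (sin ((of_int n + 1) * \<xi>) - \<tau>\<^sup>2 * sin ((of_int n - 1) * \<xi>)) / sin \<xi>"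

lemma plane_wave_add: "plane_wave \<xi> (m + n) = plane_wave \<xi> m * plane_wave \<xi> n"
  by (simp add: plane_wave_def algebra_simps flip: exp_add)

lemma plane_wave_diff_uminus:
  "plane_wave \<xi> n - plane_wave \<xi> (- n) = 2 * \<i> * of_real (sin (of_int n * \<xi>))"
proof -
  have "plane_wave \<xi> k = cis (of_int k * \<xi>)" for k
    by (simp add: plane_wave_def cis_conv_exp mult_ac)
  then show ?thesis
    by (simp add: complex_eq_iff)
qed

text \<open>Multiplication by \<open>e 1 - e (- 1)\<close>, which is 2i sin \<xi>, makes the
  geometric sum in \<open>J_op\<close> telescope, and the remaining exponentials pair up to sines.
  The result is c(\<xi>) e^(i\<xi>n) + c(-\<xi>) e^(-i\<xi>n) in real form: extending c(\<xi>) by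
  e^(i\<xi>) gives it the denominator 2i sin \<xi>.\<close>

lemma phi_eq_spherical:
  assumes "\<tau> > 0" "sin \<xi> \<noteq> 0" "n \<ge> 0"
  shows "phi \<tau> \<xi> n = of_real (spherical \<tau> \<xi> n)"
proof -
  define e where "e = plane_wave \<xi>"
  define w where "w = e 1 - e (- 1)"
  have shift: "e k * w = e (k + 1) - e (k - 1)" for k
    using plane_wave_add[of \<xi> k 1] plane_wave_add[of \<xi> k "- 1"]
    by (simp add: w_def e_def right_diff_distrib)
  have w: "w = 2 * \<i> * of_real (sin \<xi>)"
    using plane_wave_diff_uminus[of \<xi> 1] by (simp add: w_def e_def)
  then have w0: "w \<noteq> 0"
    using assms(2) by simp
  have geom: "(\<Sum>k=1..N. e (n - 2 * int k)) * w = e (n - 1) - e (n - 2 * int N - 1)" for N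
  proof (induction N)
    case (Suc N)
    then show ?case
      by (simp add: distrib_right shift)
  qed simp
  \<comment> \<open>For n > 0 the sum has n terms and carries a minus sign; for n = 0 both sides
    vanish.\<close>
  have J: "J_op e n * w = e (- n - 1) - e (n - 1)"
    using geom[of "nat n"] assms(3) by (cases "n = 0") (auto simp: J_op_def)
  have t: "complex_of_real \<tau> * of_real (\<tau> - inverse \<tau>) = of_real (\<tau>\<^sup>2) - 1"
    using assms(1) by (simp add: right_diff_distrib power2_eq_square)
  have "phi \<tau> \<xi> n * w = e n * w + of_real (\<tau>\<^sup>2) * (e (- n) * w) +
      of_real \<tau> * of_real (\<tau> - inverse \<tau>) * (J_op e n * w)"
    by (simp add: phi_def I_op_def s_op_def e_def power2_eq_square algebra_simps)
  also have "\<dots> = e (n + 1) - e (- (n + 1)) - of_real (\<tau>\<^sup>2) * (e (n - 1) - e (- (n - 1)))"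
  proof -
    have "- (n + 1) = - n - 1" "- (n - 1) = - n + 1"
      by simp_all
    then show ?thesis
      unfolding t J shift by (simp only:) (simp add: algebra_simps)
  qed
  also have "\<dots> = 2 * \<i> * of_real (sin ((of_int n + 1) * \<xi>) - \<tau>\<^sup>2 * sin ((of_int n - 1) * \<xi>))"
    unfolding e_def plane_wave_diff_uminus by (simp add: algebra_simps)
  also have "\<dots> = of_real (spherical \<tau> \<xi> n) * w"
    using assms(2) by (simp add: w spherical_def)
  finally show ?thesis
    using w0 by simp
qed

section \<open>Summation by parts and orthogonality of Jacobi eigenvectors\<close>

lemma Lam_split:
  fixes f :: "int \<Rightarrow> 'a::comm_monoid_add"
  assumes "M \<ge> 1"
  shows "(\<Sum>n\<in>Lam M. f n) = f 0 + f M + (\<Sum>n\<in>{1..M - 1}. f n)"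
proof -
  have "Lam M = insert 0 (insert M {1..M - 1})"
    using assms by auto
  then show ?thesis
    using assms by (simp add: add.assoc)
qed

lemma sum_int_telescope:
  fixes f :: "int \<Rightarrow> real"
  assumes "a \<le> b + 1"
  shows "(\<Sum>n\<in>{a..b}. f n - f (n - 1)) = f b - f (a - 1)"
proof -
  \<comment> \<open>Induction on c = b + 1 starts at the empty range, where both sides are
    0.\<close>
  have "(\<Sum>n\<in>{a..c - 1}. f n - f (n - 1)) = f (c - 1) - f (a - 1)" if "a \<le> c" for c
    using that
  proof (induction c rule: int_ge_induct)
    case base
    then show ?case by simp
  next
    case (step i)
    have "{a..i + 1 - 1} = insert i {a..i - 1}"
      using step.hyps by auto
    with step show ?case by simp
  qed
  from this[of "b + 1"] show ?thesis
    using assms by simp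
qed

text \<open>The discrete Wronskian \<open>W\<close> of the two solutions has increments
  \<open>(l - k) * (p n * r n)\<close>. The interior sum therefore telescopes to
  \<open>W (M - 1) - W 0\<close>, and the weight 1/(1 + \<tau>^2) at the two ends is exactly what
  makes the end terms cancel this difference.\<close>

lemma jacobi_eigenvectors_orthogonal:
  fixes p r :: "int \<Rightarrow> real"
  assumes "M > 1" and "l \<noteq> k"
    and p: "\<And>n. p (n + 1) + p (n - 1) = l * p n"
      "l * p 0 = (1 + \<tau>\<^sup>2) * p 1" "l * p M = (1 + \<tau>\<^sup>2) * p (M - 1)"
    and r: "\<And>n. r (n + 1) + r (n - 1) = k * r n"
      "k * r 0 = (1 + \<tau>\<^sup>2) * r 1" "k * r M = (1 + \<tau>\<^sup>2) * r (M - 1)"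
  shows "(\<Sum>n\<in>Lam M. p n * r n * Delta \<tau> M n) = 0"
proof -
  define W where "W n = p (n + 1) * r n - p n * r (n + 1)" for n
  have pos: "1 + \<tau>\<^sup>2 > 0"
    by (simp add: add_pos_nonneg)
  have W: "(l - k) * (p n * r n) = W n - W (n - 1)" for n
  proof -
    have "(l - k) * (p n * r n) = (l * p n) * r n - p n * (k * r n)"
      by (simp add: algebra_simps)
    also have "\<dots> = W n - W (n - 1)"
      unfolding p(1)[symmetric] r(1)[symmetric] W_def by (simp add: algebra_simps)
    finally show ?thesis .
  qed
  have 0: "(l - k) * (p 0 * r 0 * inverse (1 + \<tau>\<^sup>2)) = W 0"
  proof -
    have "(l - k) * (p 0 * r 0) = (l * p 0) * r 0 - p 0 * (k * r 0)"
      by (simp add: algebra_simps)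
    also have "\<dots> = (1 + \<tau>\<^sup>2) * W 0"
      unfolding p(2) r(2) W_def by (simp add: algebra_simps)
    finally show ?thesis
      using pos by (simp add: field_simps)
  qed
  have M: "(l - k) * (p M * r M * inverse (1 + \<tau>\<^sup>2)) = - W (M - 1)"
  proof -
    have "(l - k) * (p M * r M) = (l * p M) * r M - p M * (k * r M)"
      by (simp add: algebra_simps)
    also have "\<dots> = - (1 + \<tau>\<^sup>2) * W (M - 1)"
      unfolding p(3) r(3) W_def by (simp add: algebra_simps)
    finally show ?thesis
      using pos by (simp add: field_simps)
  qed
  have "(l - k) * (\<Sum>n\<in>{1..M - 1}. p n * r n * Delta \<tau> M n) = (\<Sum>n\<in>{1..M - 1}. W n - W (n - 1))"
    unfolding sum_distrib_left by (rule sum.cong) (auto simp: Delta_def simp flip: W)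
  also have "\<dots> = W (M - 1) - W 0"
    using sum_int_telescope[of 1 "M - 1" W] assms(1) by simp
  finally have "(l - k) * (\<Sum>n\<in>Lam M. p n * r n * Delta \<tau> M n) = 0"
    using 0 M assms(1) by (simp add: Lam_split Delta_def distrib_left)
  with assms(2) show ?thesis by simp
qed

section \<open>Three-term recurrence, phase function and location of the spectral points\<close>

lemma spherical_recurrence:
  "spherical \<tau> \<xi> (n + 1) + spherical \<tau> \<xi> (n - 1) = 2 * cos \<xi> * spherical \<tau> \<xi> n"
proof -
  have *: "sin ((x + 1) * \<xi>) + sin ((x - 1) * \<xi>) = 2 * cos \<xi> * sin (x * \<xi>)" for x
    by (simp add: sin_add sin_diff algebra_simps)
  show ?thesis
    using *[of "of_int n + 1"] *[of "of_int n - 1"]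
    unfolding spherical_def by (simp add: add_divide_distrib[symmetric] algebra_simps) (algebra)
qed

lemma spherical_0: "sin \<xi> \<noteq> 0 \<Longrightarrow> spherical \<tau> \<xi> 0 = 1 + \<tau>\<^sup>2"
  by (simp add: spherical_def field_simps)

lemma spherical_1: "sin \<xi> \<noteq> 0 \<Longrightarrow> spherical \<tau> \<xi> 1 = 2 * cos \<xi>"
  using sin_double[of \<xi>] by (simp add: spherical_def field_simps)

text \<open>The argument of 1 - \<tau>^2 e^(-2i\<xi>), the numerator of c(\<xi>). Its real part is
  positive for 0 < \<tau> < 1, so the principal branch of the arctangent suffices.\<close>

definition phase :: "real \<Rightarrow> real \<Rightarrow> real" where
  "phase \<tau> \<xi> = arctan (\<tau>\<^sup>2 * sin (2 * \<xi>) / (1 - \<tau>\<^sup>2 * cos (2 * \<xi>)))"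

lemma phase_denominator_pos:
  fixes \<tau> x :: real
  assumes "0 < \<tau>" "\<tau> < 1"
  shows "1 - \<tau>\<^sup>2 * cos x > 0"
proof -
  have "\<tau>\<^sup>2 * cos x \<le> \<tau>\<^sup>2"
    using mult_left_mono[OF cos_le_one[of x], of "\<tau>\<^sup>2"] by simp
  moreover have "\<tau>\<^sup>2 < 1"
    using assms by (simp add: power_less_one_iff)
  ultimately show ?thesis by simp
qed

lemma phase_polar:
  assumes "0 < \<tau>" "\<tau> < 1"
  obtains R where "R * cos (phase \<tau> \<xi>) = 1 - \<tau>\<^sup>2 * cos (2 * \<xi>)"
    "R * sin (phase \<tau> \<xi>) = \<tau>\<^sup>2 * sin (2 * \<xi>)"
    "R\<^sup>2 = 1 + \<tau>^4 - 2 * \<tau>\<^sup>2 * cos (2 * \<xi>)"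
proof -
  define x y where "x = 1 - \<tau>\<^sup>2 * cos (2 * \<xi>)" and "y = \<tau>\<^sup>2 * sin (2 * \<xi>)"
  have x: "x > 0"
    unfolding x_def by (rule phase_denominator_pos[OF assms])
  \<comment> \<open>This is the modulus of 1 - \<tau>^2 e^(-2i\<xi>).\<close>
  define R where "R = x / cos (phase \<tau> \<xi>)"
  have c: "cos (phase \<tau> \<xi>) > 0"
    unfolding phase_def cos_arctan by (simp add: add_pos_nonneg)
  have 1: "R * cos (phase \<tau> \<xi>) = x"
    using c by (simp add: R_def)
  have "tan (phase \<tau> \<xi>) = y / x"
    unfolding phase_def x_def y_def by (rule tan_arctan)
  then have 2: "R * sin (phase \<tau> \<xi>) = y"
    using c x by (simp add: R_def tan_def field_simps)
  have "R\<^sup>2 = (R * cos (phase \<tau> \<xi>))\<^sup>2 + (R * sin (phase \<tau> \<xi>))\<^sup>2"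
    by (simp add: power_mult_distrib flip: distrib_left)
  also have "\<dots> = 1 + \<tau>^4 - 2 * \<tau>\<^sup>2 * cos (2 * \<xi>)"
    unfolding 1 2 x_def y_def power_mult_distrib sin_squared_eq[of "2 * \<xi>"]
    by (simp add: power2_eq_square power4_eq_xxxx algebra_simps)
  finally show ?thesis
    using that 1 2 by (simp add: x_def y_def)
qed

text \<open>Both sides vanish at 0 and have the same derivative. This evaluates the integral:
  \<open>theta\<close> is 2\<xi> plus twice the phase, which connects the quantization condition
  with the polar form of the spherical function.\<close>

lemma V_eq:
  assumes "0 < \<tau>" "\<tau> < 1"
  shows "V \<tau> M \<xi> = (of_int M + 2) * \<xi> + 2 * phase \<tau> \<xi>"
proof -
  define g where "g \<xi> = V \<tau> M \<xi> - ((of_int M + 2) * \<xi> + 2 * phase \<tau> \<xi>)" for \<xi>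
  have "(g has_real_derivative 0) (at x)" for x
  proof -
    define X Y D where "X = 1 - \<tau>\<^sup>2 * cos (2 * x)" and "Y = \<tau>\<^sup>2 * sin (2 * x)"
      and "D = 1 + \<tau>^4 - 2 * \<tau>\<^sup>2 * cos (2 * x)"
    have X: "X > 0" and D: "D > 0"
      unfolding X_def D_def by (rule phase_denominator_pos[OF assms] denominator_pos[OF assms])+
    have sq: "(sin (2 * x))\<^sup>2 = 1 - (cos (2 * x))\<^sup>2"
      by (rule sin_squared_eq)
    have XY: "X\<^sup>2 + Y\<^sup>2 = D"
      unfolding X_def Y_def D_def power_mult_distrib sq
      by (simp add: power2_eq_square power4_eq_xxxx algebra_simps)
    have "((\<lambda>x. \<tau>\<^sup>2 * sin (2 * x) / (1 - \<tau>\<^sup>2 * cos (2 * x))) has_real_derivative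
        (2 * \<tau>\<^sup>2 * cos (2 * x) * X - Y * (2 * Y)) / (X * X)) (at x)"
      using X unfolding X_def Y_def by (auto intro!: derivative_eq_intros simp: algebra_simps)
    from DERIV_chain2[OF DERIV_arctan this]
    have "(phase \<tau> has_real_derivative
        inverse (1 + (Y / X)\<^sup>2) * ((2 * \<tau>\<^sup>2 * cos (2 * x) * X - Y * (2 * Y)) / (X * X))) (at x)"
      unfolding phase_def X_def Y_def .
    also have "inverse (1 + (Y / X)\<^sup>2) * ((2 * \<tau>\<^sup>2 * cos (2 * x) * X - Y * (2 * Y)) / (X * X)) =
        (2 * \<tau>\<^sup>2 * cos (2 * x) * X - 2 * Y\<^sup>2) / (X\<^sup>2 + Y\<^sup>2)"
    proof -
      have "1 + (Y / X)\<^sup>2 = (X\<^sup>2 + Y\<^sup>2) / X\<^sup>2"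
        using X by (simp add: field_simps)
      moreover have "X\<^sup>2 + Y\<^sup>2 > 0"
        using X by (simp add: add_pos_nonneg)
      ultimately show ?thesis
        using X by (simp add: divide_simps power2_eq_square)
    qed
    \<comment> \<open>In the numerator, the squares of cosine and sine, each with coefficient
      -2\<tau>^4, add up to -2\<tau>^4.\<close>
    also have "\<dots> = (2 * \<tau>\<^sup>2 * cos (2 * x) - 2 * \<tau>^4) / D"
      unfolding XY unfolding X_def Y_def power_mult_distrib sq
      by (simp add: power2_eq_square power4_eq_xxxx algebra_simps)
    finally have ph: "(phase \<tau> has_real_derivative (2 * \<tau>\<^sup>2 * cos (2 * x) - 2 * \<tau>^4) / D) (at x)" .
    have "(g has_real_derivative of_int M + 2 * (1 - \<tau>^4) / D -
        ((of_int M + 2) * 1 + 2 * ((2 * \<tau>\<^sup>2 * cos (2 * x) - 2 * \<tau>^4) / D))) (at x)"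
      unfolding g_def D_def
      by (intro DERIV_diff DERIV_add DERIV_cmult DERIV_ident V_has_real_derivative[OF assms] ph[unfolded D_def])
    also have "2 * (1 - \<tau>^4) / D = 2 + 2 * ((2 * \<tau>\<^sup>2 * cos (2 * x) - 2 * \<tau>^4) / D)"
      using D by (simp add: field_simps) (simp add: D_def algebra_simps)
    finally show ?thesis by simp
  qed
  then have "g \<xi> = g 0"
    by (metis DERIV_isconst_all)
  moreover have "g 0 = 0"
    by (simp add: g_def phase_def V_def theta_def zero_ereal_def[symmetric])
  ultimately show ?thesis
    by (simp add: g_def)
qed

text \<open>\<open>V\<close> is strictly increasing with V(0) = 0 and V(pi) = (M + 2) pi, since the
  phase vanishes at both points; the targets (m + 1) pi lie strictly between these values.\<close>

lemma xi_props:
  assumes "0 < \<tau>" "\<tau> < 1" "M > 1" "m \<in> Lam M"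
  shows V_xi: "V \<tau> M (xi \<tau> M m) = (of_int m + 1) * pi"
    and xi_bounds: "0 < xi \<tau> M m" "xi \<tau> M m < pi"
proof -
  let ?x = "xi \<tau> M m"
  show V: "V \<tau> M ?x = (of_int m + 1) * pi"
    unfolding xi_def by (rule theI'[OF xi_ex1[OF assms]])
  have t4: "0 < 1 - \<tau>^4"
    using assms by (simp add: power_less_one_iff)
  have deriv: "of_int M + 2 * (1 - \<tau>^4) / (1 + \<tau>^4 - 2 * \<tau>\<^sup>2 * cos (2 * x)) > 0" for x
    using denominator_pos[OF assms(1,2), of "2 * x"] t4 assms(3) by (simp add: add_pos_pos)
  have mono: "V \<tau> M x < V \<tau> M y" if "x < y" for x y
    by (rule DERIV_pos_imp_increasing[OF that])
       (use V_has_real_derivative[OF assms(1,2)] deriv in blast)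
  have "V \<tau> M 0 < V \<tau> M ?x"
    using assms(4) by (simp add: V V_eq[OF assms(1,2), of _ 0] phase_def)
  then show "0 < ?x"
    using mono[of ?x 0] by (cases "?x = 0") force+
  have "V \<tau> M pi = (of_int M + 2) * pi"
    using V_eq[OF assms(1,2), of M pi] by (simp add: phase_def)
  moreover have "(of_int m + 1) * pi < (of_int M + 2) * pi"
    using assms(4) by simp
  ultimately have "V \<tau> M ?x < V \<tau> M pi"
    by (simp add: V)
  then show "?x < pi"
    using mono[of pi ?x] by (cases "?x = pi") force+
qed

text \<open>The cosine is injective on [0, pi], and the value of \<open>V\<close> at the common
  point recovers the index. This separates the eigenvalues.\<close>

lemma cos_xi_inj:
  assumes "0 < \<tau>" "\<tau> < 1" "M > 1" "m \<in> Lam M" "m' \<in> Lam M"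
    and "cos (xi \<tau> M m) = cos (xi \<tau> M m')"
  shows "m = m'"
proof -
  have "xi \<tau> M m = xi \<tau> M m'"
    by (rule cos_inj_pi[OF _ _ _ _ assms(6)])
       (use xi_bounds[OF assms(1-4)] xi_bounds[OF assms(1-3,5)] in linarith)+
  then have "(of_int m + 1) * pi = (of_int m' + 1) * pi"
    using V_xi[OF assms(1-4)] V_xi[OF assms(1-3,5)] by metis
  then show ?thesis by simp
qed

section \<open>Polar form, reflection symmetry and norm of the spherical function\<close>

lemma spherical_polar:
  assumes "sin \<xi> \<noteq> 0" "R * cos (phase \<tau> \<xi>) = 1 - \<tau>\<^sup>2 * cos (2 * \<xi>)"
    "R * sin (phase \<tau> \<xi>) = \<tau>\<^sup>2 * sin (2 * \<xi>)"
  shows "sin \<xi> * spherical \<tau> \<xi> n = R * sin ((of_int n + 1) * \<xi> + phase \<tau> \<xi>)"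
proof -
  define x where "x = (of_int n + 1) * \<xi>"
  \<comment> \<open>Both sides of the chain are the imaginary part of e^(ix) (1 - \<tau>^2
    e^(-2i\<xi>)).\<close>
  have "R * sin (x + phase \<tau> \<xi>) = sin x * (R * cos (phase \<tau> \<xi>)) + cos x * (R * sin (phase \<tau> \<xi>))"
    by (simp add: sin_add algebra_simps)
  also have "\<dots> = sin x - \<tau>\<^sup>2 * sin (x - 2 * \<xi>)"
    unfolding assms by (simp add: sin_diff algebra_simps)
  also have "x - 2 * \<xi> = (of_int n - 1) * \<xi>"
    by (simp add: x_def algebra_simps)
  finally show ?thesis
    using assms(1) by (simp add: spherical_def x_def)
qed

text \<open>The polar angles at n and M - n add up to V(\<xi>). Where sin V(\<xi>) = 0, passing from
  one angle to the other changes the sine only by the sign -cos V(\<xi>).\<close>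

lemma spherical_reflect:
  assumes "0 < \<tau>" "\<tau> < 1" "sin \<xi> \<noteq> 0" "sin (V \<tau> M \<xi>) = 0"
  shows "spherical \<tau> \<xi> (M - n) = - cos (V \<tau> M \<xi>) * spherical \<tau> \<xi> n"
proof -
  obtain R where R: "R * cos (phase \<tau> \<xi>) = 1 - \<tau>\<^sup>2 * cos (2 * \<xi>)"
    "R * sin (phase \<tau> \<xi>) = \<tau>\<^sup>2 * sin (2 * \<xi>)"
    by (rule phase_polar[OF assms(1,2)])
  note polar = spherical_polar[OF assms(3) R]
  have reflect: "(of_int (M - n) + 1) * \<xi> + phase \<tau> \<xi> =
      V \<tau> M \<xi> - ((of_int n + 1) * \<xi> + phase \<tau> \<xi>)"
    by (simp add: V_eq[OF assms(1,2)] algebra_simps)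
  have "sin \<xi> * spherical \<tau> \<xi> (M - n) = - cos (V \<tau> M \<xi>) * (sin \<xi> * spherical \<tau> \<xi> n)"
    unfolding polar reflect by (simp add: sin_diff assms(4))
  then have "sin \<xi> * spherical \<tau> \<xi> (M - n) = sin \<xi> * (- cos (V \<tau> M \<xi>) * spherical \<tau> \<xi> n)"
    by simp
  then show ?thesis
    unfolding mult_cancel_left using assms(3) by simp
qed

text \<open>The squared polar form is a constant minus a cosine in arithmetic progression. The
  unweighted sum \<open>A\<close> is computed by telescoping, and the two end terms are then
  corrected for their weight.\<close>

lemma spherical_norm:
  assumes "0 < \<tau>" "\<tau> < 1" "M > 1" "sin \<xi> \<noteq> 0" "sin (V \<tau> M \<xi>) = 0"
  defines "D \<equiv> 1 + \<tau>^4 - 2 * \<tau>\<^sup>2 * cos (2 * \<xi>)"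
  shows "(\<Sum>n\<in>Lam M. (spherical \<tau> \<xi> n)\<^sup>2 * Delta \<tau> M n) =
    D / (1 - cos (2 * \<xi>)) * (of_int M + 2 * (1 - \<tau>^4) / D)"
proof -
  obtain R where R: "R * cos (phase \<tau> \<xi>) = 1 - \<tau>\<^sup>2 * cos (2 * \<xi>)"
    "R * sin (phase \<tau> \<xi>) = \<tau>\<^sup>2 * sin (2 * \<xi>)" "R\<^sup>2 = D"
    unfolding D_def by (rule phase_polar[OF assms(1,2)])
  have D: "D > 0"
    unfolding D_def by (rule denominator_pos[OF assms(1,2)])
  define a s where "a = phase \<tau> \<xi>" and "s = sin \<xi>"
  have s: "s \<noteq> 0"
    using assms(4) by (simp add: s_def)
  define ph where "ph n = (of_int n + 1) * \<xi> + a" for n :: int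
  have polar: "s * spherical \<tau> \<xi> n = R * sin (ph n)" for n
    unfolding ph_def a_def s_def by (rule spherical_polar[OF assms(4) R(1,2)])
  have half: "2 * s\<^sup>2 * (spherical \<tau> \<xi> n)\<^sup>2 = D * (1 - cos (2 * ph n))" for n
  proof -
    have "2 * s\<^sup>2 * (spherical \<tau> \<xi> n)\<^sup>2 = 2 * (s * spherical \<tau> \<xi> n)\<^sup>2"
      by (simp add: power_mult_distrib)
    also have "\<dots> = D * (2 * (sin (ph n))\<^sup>2)"
      unfolding polar R(3)[symmetric] by (simp add: power_mult_distrib)
    also have "2 * (sin (ph n))\<^sup>2 = 1 - cos (2 * ph n)"
      by (simp add: cos_double_sin)
    finally show ?thesis .
  qed
  \<comment> \<open>The angle \<open>2 * ph n\<close> advances by 2\<xi>, so the factor 2 sin \<xi>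
    turns each cosine into a difference of consecutive sines.\<close>
  have "2 * s * cos (2 * ph n) = sin (2 * ph n + \<xi>) - sin (2 * ph (n - 1) + \<xi>)" for n
  proof -
    have shift: "2 * ph (n - 1) + \<xi> = 2 * ph n - \<xi>"
      by (simp add: ph_def algebra_simps)
    show ?thesis
      unfolding shift by (simp add: sin_add sin_diff s_def)
  qed
  then have "2 * s * (\<Sum>n\<in>Lam M. cos (2 * ph n)) = sin (2 * ph M + \<xi>) - sin (2 * ph (- 1) + \<xi>)"
    using sum_int_telescope[of 0 M "\<lambda>n. sin (2 * ph n + \<xi>)"] assms(3)
    by (simp add: sum_distrib_left)
  \<comment> \<open>Since sin V(\<xi>) = 0, the shift by 2 V(\<xi>) has no effect, and the upper end
    contributes the same -sin(\<xi> + 2a) as the lower one.\<close>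
  also have "2 * ph M + \<xi> = 2 * V \<tau> M \<xi> - (\<xi> + 2 * a)"
    by (simp add: ph_def a_def V_eq[OF assms(1,2)] algebra_simps)
  also have "sin (2 * V \<tau> M \<xi> - (\<xi> + 2 * a)) = - sin (\<xi> + 2 * a)"
    using assms(5) by (simp add: sin_diff[of "2 * V \<tau> M \<xi>"] cos_double_sin sin_double)
  also have "2 * ph (- 1) + \<xi> = \<xi> + 2 * a"
    by (simp add: ph_def)
  finally have tel: "s * (\<Sum>n\<in>Lam M. cos (2 * ph n)) = - sin (\<xi> + 2 * a)"
    by simp
  \<comment> \<open>The left side is the imaginary part of e^(i\<xi>) (R e^(ia))^2; inserting the
    coordinates of R e^(ia) removes the phase and leaves a polynomial in s and \<tau>.\<close>
  have boundary: "D * sin (\<xi> + 2 * a) = s * (1 + 2 * \<tau>\<^sup>2 - \<tau>^4 * (3 - 4 * s\<^sup>2))"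
  proof -
    have sin_sum: "sin (\<xi> + 2 * a) = s * ((cos a)\<^sup>2 - (sin a)\<^sup>2) + 2 * cos \<xi> * cos a * sin a"
      by (simp add: sin_add sin_double cos_double s_def)
    have "D * sin (\<xi> + 2 * a) =
        s * ((R * cos a)\<^sup>2 - (R * sin a)\<^sup>2) + 2 * cos \<xi> * (R * cos a) * (R * sin a)"
      unfolding R(3)[symmetric] sin_sum by (simp add: power2_eq_square algebra_simps)
    also have "\<dots> = s * ((1 - \<tau>\<^sup>2 * cos (2 * \<xi>))\<^sup>2 - (\<tau>\<^sup>2 * (2 * s * cos \<xi>))\<^sup>2) +
        2 * cos \<xi> * (1 - \<tau>\<^sup>2 * cos (2 * \<xi>)) * (\<tau>\<^sup>2 * (2 * s * cos \<xi>))"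
      unfolding a_def R sin_double s_def ..
    also have "\<dots> = s * ((1 - \<tau>\<^sup>2 * (1 - 2 * s\<^sup>2))\<^sup>2 - \<tau>^4 * (4 * s\<^sup>2 * (1 - s\<^sup>2)) +
        4 * \<tau>\<^sup>2 * (1 - s\<^sup>2) * (1 - \<tau>\<^sup>2 * (1 - 2 * s\<^sup>2)))"
    proof -
      have c: "cos (2 * \<xi>) = 1 - 2 * s\<^sup>2" "1 - s\<^sup>2 = cos \<xi> * cos \<xi>"
        by (simp_all add: s_def cos_double_sin cos_squared_eq flip: power2_eq_square)
      show ?thesis
        unfolding c by (simp add: power2_eq_square power4_eq_xxxx algebra_simps)
    qed
    also have "\<dots> = s * (1 + 2 * \<tau>\<^sup>2 - \<tau>^4 * (3 - 4 * s\<^sup>2))"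
      by (simp add: power2_eq_square power4_eq_xxxx algebra_simps)
    finally show ?thesis .
  qed
  define A where "A = (\<Sum>n\<in>Lam M. (spherical \<tau> \<xi> n)\<^sup>2)"
  have A_sum: "2 * s\<^sup>2 * A = D * (of_int M + 1 - (\<Sum>n\<in>Lam M. cos (2 * ph n)))"
    using assms(3)
    unfolding A_def sum_distrib_left half by (simp add: sum_subtractf flip: sum_distrib_left)
  have "s * (2 * s\<^sup>2 * A) = s * (D * (of_int M + 1)) - D * (s * (\<Sum>n\<in>Lam M. cos (2 * ph n)))"
    unfolding A_sum by (simp add: algebra_simps)
  then have "s * (2 * s\<^sup>2 * A) = s * (D * (of_int M + 1)) + D * sin (\<xi> + 2 * a)"
    unfolding tel by simp
  then have A: "2 * s\<^sup>2 * A = D * (of_int M + 1) + (1 + 2 * \<tau>\<^sup>2 - \<tau>^4 * (3 - 4 * s\<^sup>2))"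
    unfolding boundary distrib_left[symmetric] using s by simp
  have M0: "spherical \<tau> \<xi> M = - cos (V \<tau> M \<xi>) * spherical \<tau> \<xi> 0"
    using spherical_reflect[OF assms(1,2,4,5), of 0] by simp
  have "(cos (V \<tau> M \<xi>))\<^sup>2 = 1"
    using assms(5) by (simp add: cos_squared_eq)
  then have ends: "(spherical \<tau> \<xi> 0)\<^sup>2 = (1 + \<tau>\<^sup>2)\<^sup>2" "(spherical \<tau> \<xi> M)\<^sup>2 = (1 + \<tau>\<^sup>2)\<^sup>2"
    by (simp_all add: M0 power_mult_distrib spherical_0[OF assms(4)])
  have "(\<Sum>n\<in>{1..M - 1}. (spherical \<tau> \<xi> n)\<^sup>2 * Delta \<tau> M n) = (\<Sum>n\<in>{1..M - 1}. (spherical \<tau> \<xi> n)\<^sup>2)"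
    by (rule sum.cong) (auto simp: Delta_def)
  also have "\<dots> = A - 2 * (1 + \<tau>\<^sup>2)\<^sup>2"
    using assms(3) by (simp add: A_def Lam_split ends)
  \<comment> \<open>Each end has squared value (1 + \<tau>^2)^2, so with its weight it contributes 1
    + \<tau>^2.\<close>
  moreover have "(1 + \<tau>\<^sup>2)\<^sup>2 * inverse (1 + \<tau>\<^sup>2) = 1 + \<tau>\<^sup>2"
    using add_pos_nonneg[OF zero_less_one zero_le_power2[of \<tau>]] by (simp add: power2_eq_square)
  ultimately have "(\<Sum>n\<in>Lam M. (spherical \<tau> \<xi> n)\<^sup>2 * Delta \<tau> M n) =
      A - 2 * (1 + \<tau>\<^sup>2)\<^sup>2 + 2 * (1 + \<tau>\<^sup>2)"
    using assms(3) by (simp add: Lam_split[where M = M] ends Delta_def)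
  also have "\<dots> = A - 2 * \<tau>\<^sup>2 * (1 + \<tau>\<^sup>2)"
    by (simp add: power2_eq_square algebra_simps)
  also have "\<dots> = (D * of_int M + 2 * (1 - \<tau>^4)) / (2 * s\<^sup>2)"
  proof -
    have "D = 1 + \<tau>^4 - 2 * \<tau>\<^sup>2 * (1 - 2 * s\<^sup>2)"
      by (simp add: D_def s_def cos_double_sin)
    then have "2 * s\<^sup>2 * (A - 2 * \<tau>\<^sup>2 * (1 + \<tau>\<^sup>2)) = D * of_int M + 2 * (1 - \<tau>^4)"
      unfolding right_diff_distrib A by (simp add: power2_eq_square power4_eq_xxxx algebra_simps)
    then show ?thesis
      using s by (simp add: field_simps)
  qed
  also have "\<dots> = D / (1 - cos (2 * \<xi>)) * (of_int M + 2 * (1 - \<tau>^4) / D)"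
    using D by (simp add: s_def cos_double_sin add_divide_distrib distrib_left)
  finally show ?thesis .
qed

section \<open>Orthogonal bases of functions on \<Lambda> and their dual relations\<close>

lemma sum_cfun_apply: "(\<Sum>i\<in>A. f i) x = (\<Sum>i\<in>A. f i x :: 'a::comm_monoid_add)"
  by (induction A rule: infinite_finite_induct) auto

lemma inner_l2_sum:
  "inner_l2 M w (\<Sum>i\<in>A. cfun_scale (a i) (F i)) g = (\<Sum>i\<in>A. a i * inner_l2 M w (F i) g)"
  unfolding inner_l2_def sum_cfun_apply cfun_scale_def sum_distrib_left sum_distrib_right
  by (subst sum.swap) (simp add: mult_ac)

text \<open>Indicator functions span, which bounds the size of every independent family by the
  cardinality of \<Lambda>.\<close>

lemma Lam_functions_span:
  "Lam_functions M = cfun.span ((\<lambda>k n. of_bool (n = k)) ` Lam M)" (is "_ = cfun.span ?B")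
proof
  show "Lam_functions M \<subseteq> cfun.span ?B"
  proof
    fix f assume "f \<in> Lam_functions M"
    then have "f x = (\<Sum>k\<in>Lam M. if x = k then f k else 0)" for x
      by (simp add: Lam_functions_def)
    also have "(\<Sum>k\<in>Lam M. if x = k then f k else 0) =
        (\<Sum>k\<in>Lam M. cfun_scale (f k) (\<lambda>n. of_bool (n = k))) x" for x
      unfolding sum_cfun_apply cfun_scale_def by (intro sum.cong) auto
    finally have "f = (\<Sum>k\<in>Lam M. cfun_scale (f k) (\<lambda>n. of_bool (n = k)))"
      by (rule ext)
    also have "\<dots> \<in> cfun.span ?B"
      by (intro cfun.span_sum cfun.span_scale cfun.span_base) auto
    finally show "f \<in> cfun.span ?B" .
  qed
  show "cfun.span ?B \<subseteq> Lam_functions M"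
    by (rule cfun.span_minimal)
      (auto simp: Lam_functions_def cfun.subspace_def cfun_scale_def)
qed

text \<open>Nonzero norms give injectivity and, by pairing a vanishing combination with one member,
  independence. Spanning follows by counting against the indicator functions.\<close>

lemma orthogonal_basisI:
  assumes F: "\<And>i. i \<in> Lam M \<Longrightarrow> F i \<in> Lam_functions M"
    and inner: "\<And>i j. i \<in> Lam M \<Longrightarrow> j \<in> Lam M \<Longrightarrow>
      inner_l2 M w (F i) (F j) = (if i = j then N i else 0)"
    and N: "\<And>i. i \<in> Lam M \<Longrightarrow> N i \<noteq> 0"
  shows "orthogonal_basis M w F"
proof -
  have inj: "inj_on F (Lam M)"
    using inner N by (intro inj_onI) metis
  have indep: "cfun.independent (F ` Lam M)"
    unfolding cfun.dependent_finite[OF finite_imageI[OF finite_atLeastAtMost_int]]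
  proof clarify
    fix a i
    assume 0: "(\<Sum>v\<in>F ` Lam M. cfun_scale (a v) v) = 0" and i: "i \<in> Lam M" "a (F i) \<noteq> 0"
    have "0 = inner_l2 M w (\<Sum>j\<in>Lam M. cfun_scale (a (F j)) (F j)) (F i)"
      using 0 by (simp add: sum.reindex[OF inj] inner_l2_def)
    also have "\<dots> = (\<Sum>j\<in>Lam M. a (F j) * (if j = i then N j else 0))"
      unfolding inner_l2_sum using i(1) by (intro sum.cong) (auto simp: inner)
    also have "\<dots> = a (F i) * N i"
      using i(1) by (simp add: if_distrib cong: if_cong)
    finally show False
      using N i by simp
  qed
  let ?B = "(\<lambda>k n. of_bool (n = k) :: complex) ` Lam M"
  have sub: "F ` Lam M \<subseteq> Lam_functions M"
    using F by auto
  have "Lam_functions M \<subseteq> cfun.span (F ` Lam M)"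
  proof (rule ccontr)
    assume "\<not> ?thesis"
    \<comment> \<open>A function outside the span would enlarge the family to one more independent
      vector than there are points in \<Lambda>.\<close>
    then obtain v where v: "v \<in> Lam_functions M" "v \<notin> cfun.span (F ` Lam M)"
      by auto
    then have "cfun.independent (insert v (F ` Lam M))"
      using indep by (simp add: cfun.independent_insert)
    moreover have "insert v (F ` Lam M) \<subseteq> cfun.span ?B"
      using sub v(1) Lam_functions_span by simp
    ultimately have "card (insert v (F ` Lam M)) \<le> card ?B"
      using cfun.independent_span_bound[of ?B "insert v (F ` Lam M)"] by simp
    also have "\<dots> \<le> card (Lam M)"
      by (rule card_image_le) simp
    finally show False
      using v(2) cfun.span_base[of v "F ` Lam M"] by (metis card_image card_insert_disjoint
          finite_atLeastAtMost_int finite_imageI inj not_less_eq_eq order_refl)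
  qed
  moreover have "cfun.span (F ` Lam M) \<subseteq> Lam_functions M"
    using sub unfolding Lam_functions_span by (metis cfun.span_mono cfun.span_span)
  ultimately show ?thesis
    using inj indep inner by (auto simp: orthogonal_basis_def)
qed

text \<open>The indicator function of k is expanded in the basis, its coefficients are found by
  pairing with each member, and the expansion is evaluated at n. Here \<open>N\<close> holds the
  reciprocals of the squared norms, so it becomes the dual weight.\<close>

lemma orthogonal_basis_dual:
  assumes basis: "orthogonal_basis M w F"
    and inner: "\<And>i. i \<in> Lam M \<Longrightarrow> inner_l2 M w (F i) (F i) = inverse (N i)"
    and N: "\<And>i. i \<in> Lam M \<Longrightarrow> N i \<noteq> 0"
    and n: "n \<in> Lam M" "k \<in> Lam M" "w k \<noteq> 0"
  shows "(\<Sum>m\<in>Lam M. F m n * cnj (F m k) * N m) = (if n = k then inverse (of_real (w k)) else 0)"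
proof -
  define d :: "int \<Rightarrow> complex" where "d = (\<lambda>n. of_bool (n = k))"
  have inj: "inj_on F (Lam M)"
    using basis by (simp add: orthogonal_basis_def)
  have "d \<in> Lam_functions M"
    using n(2) by (auto simp: Lam_functions_def d_def)
  then have "d \<in> cfun.span (F ` Lam M)"
    using basis by (simp add: orthogonal_basis_def)
  then obtain u where "d = (\<Sum>v\<in>F ` Lam M. cfun_scale (u v) v)"
    by (auto simp: cfun.span_finite)
  then have d: "d = (\<Sum>m\<in>Lam M. cfun_scale (u (F m)) (F m))"
    by (simp add: sum.reindex[OF inj])
  have u: "u (F m) = of_real (w k) * (cnj (F m k) * N m)" if m: "m \<in> Lam M" for m
  proof -
    have "cnj (F m k) * of_real (w k) = inner_l2 M w d (F m)"
      using n(2) by (simp add: inner_l2_def d_def of_bool_def if_distrib[of "\<lambda>x. x * _"] cong: if_cong)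
    also have "\<dots> = (\<Sum>j\<in>Lam M. u (F j) * (if j = m then inverse (N m) else 0))"
      unfolding d inner_l2_sum
      using basis m inner by (intro sum.cong) (auto simp: orthogonal_basis_def)
    also have "\<dots> = u (F m) * inverse (N m)"
      using m by (simp add: if_distrib cong: if_cong)
    finally show ?thesis
      using N[OF m] by (simp add: field_simps)
  qed
  have "of_bool (n = k) = (\<Sum>m\<in>Lam M. u (F m) * F m n)"
    using arg_cong[OF d, of "\<lambda>f. f n"] by (simp add: d_def sum_cfun_apply cfun_scale_def)
  also have "\<dots> = of_real (w k) * (\<Sum>m\<in>Lam M. F m n * cnj (F m k) * N m)"
    unfolding sum_distrib_left by (intro sum.cong) (auto simp: u mult_ac)
  finally show ?thesis
    using n(3) by (simp add: field_simps of_bool_def split: if_splits)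
qed

section \<open>Orthogonality at the spectral points and the two dual bases\<close>

lemma xi_sin:
  assumes "0 < \<tau>" "\<tau> < 1" "M > 1" "m \<in> Lam M"
  shows sin_xi: "sin (xi \<tau> M m) > 0" and sin_V_xi: "sin (V \<tau> M (xi \<tau> M m)) = 0"
proof -
  show "sin (xi \<tau> M m) > 0"
    using xi_bounds[OF assms] by (rule sin_gt_zero)
  show "sin (V \<tau> M (xi \<tau> M m)) = 0"
    unfolding V_xi[OF assms] using sin_npi_int[of "m + 1"] by (simp add: mult.commute)
qed

lemma Delta_hat_pos:
  assumes "0 < \<tau>" "\<tau> < 1" "M > 1" "m \<in> Lam M"
  shows "Delta_hat \<tau> M m > 0"
proof -
  have "1 - \<tau>^4 > 0"
    using assms by (simp add: power_less_one_iff)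
  moreover have "1 - cos (2 * xi \<tau> M m) > 0"
    using sin_xi[OF assms] by (simp add: cos_double_sin)
  ultimately show ?thesis
    using denominator_pos[OF assms(1,2), of "2 * xi \<tau> M m"] assms(3)
    unfolding Delta_hat_eq[OF assms(1,2)]
    by (intro mult_pos_pos divide_pos_pos positive_imp_inverse_positive add_pos_pos) simp_all
qed

text \<open>The condition at 0 follows from the explicit values at 0 and 1. The one at M is its
  mirror image under \<open>spherical_reflect\<close>, and this is where the quantization condition
  enters.\<close>

lemma spherical_xi_boundary:
  assumes "0 < \<tau>" "\<tau> < 1" "M > 1" "m \<in> Lam M"
  defines "\<xi> \<equiv> xi \<tau> M m"
  shows "2 * cos \<xi> * spherical \<tau> \<xi> 0 = (1 + \<tau>\<^sup>2) * spherical \<tau> \<xi> 1"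
    and "2 * cos \<xi> * spherical \<tau> \<xi> M = (1 + \<tau>\<^sup>2) * spherical \<tau> \<xi> (M - 1)"
proof -
  have s: "sin \<xi> \<noteq> 0"
    using sin_xi[OF assms(1-4)] by (simp add: \<xi>_def)
  show left: "2 * cos \<xi> * spherical \<tau> \<xi> 0 = (1 + \<tau>\<^sup>2) * spherical \<tau> \<xi> 1"
    by (simp add: spherical_0[OF s] spherical_1[OF s])
  have refl: "spherical \<tau> \<xi> (M - n) = - cos (V \<tau> M \<xi>) * spherical \<tau> \<xi> n" for n
    using spherical_reflect[OF assms(1,2) s] sin_V_xi[OF assms(1-4)] by (simp add: \<xi>_def)
  have "2 * cos \<xi> * spherical \<tau> \<xi> (M - 0) = - cos (V \<tau> M \<xi>) * (2 * cos \<xi> * spherical \<tau> \<xi> 0)"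
    unfolding refl by simp
  also have "\<dots> = (1 + \<tau>\<^sup>2) * spherical \<tau> \<xi> (M - 1)"
    unfolding left refl by simp
  finally show "2 * cos \<xi> * spherical \<tau> \<xi> M = (1 + \<tau>\<^sup>2) * spherical \<tau> \<xi> (M - 1)"
    by simp
qed

lemma spherical_orthogonality:
  assumes "0 < \<tau>" "\<tau> < 1" "M > 1" "m \<in> Lam M" "m' \<in> Lam M"
  shows "(\<Sum>n\<in>Lam M. spherical \<tau> (xi \<tau> M m) n * spherical \<tau> (xi \<tau> M m') n * Delta \<tau> M n) =
    (if m = m' then inverse (Delta_hat \<tau> M m) else 0)"
proof (cases "m = m'")
  case True
  have "sin (xi \<tau> M m) \<noteq> 0"
    using sin_xi[OF assms(1-4)] by simp
  from spherical_norm[OF assms(1-3) this sin_V_xi[OF assms(1-4)]] show ?thesis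
    unfolding Delta_hat_eq[OF assms(1,2)] True inverse_mult_distrib inverse_inverse_eq inverse_divide
    by (simp add: power2_eq_square)
next
  case False
  then have "2 * cos (xi \<tau> M m) \<noteq> 2 * cos (xi \<tau> M m')"
    using cos_xi_inj[OF assms] by auto
  from jacobi_eigenvectors_orthogonal[OF assms(3) this
      spherical_recurrence spherical_xi_boundary[OF assms(1-4)]
      spherical_recurrence spherical_xi_boundary[OF assms(1-3,5)]]
  show ?thesis using False by simp
qed

lemma Phi_kernel_eq_spherical:
  assumes "0 < \<tau>" "\<tau> < 1" "M > 1" "m \<in> Lam M" "n \<in> Lam M"
  shows "Phi_kernel \<tau> M m n = of_real (spherical \<tau> (xi \<tau> M m) n)"
proof -
  have "sin (xi \<tau> M m) \<noteq> 0"
    using sin_xi[OF assms(1-4)] by simp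
  then show ?thesis
    using assms by (simp add: Phi_kernel_def Phi_Lam phi_eq_spherical)
qed

theorem theorem7p2:
  fixes \<tau> :: real and M :: int
  assumes "0 < \<tau>" and "\<tau> < 1" and "M > 1"
  shows "(\<forall>m\<in>Lam M. \<forall>n\<in>Lam M. Phi_kernel \<tau> M m n \<in> \<real>) \<and>
         (orthogonal_basis M (Delta \<tau> M) (\<lambda>m. (\<lambda>n. Phi_kernel \<tau> M m n)) \<and>
         (\<forall>m\<in>Lam M. \<forall>m'\<in>Lam M.
            inner_l2 M (Delta \<tau> M) (\<lambda>n. Phi_kernel \<tau> M m n) (\<lambda>n. Phi_kernel \<tau> M m' n) =
              (\<Sum>n=0..M. Phi_kernel \<tau> M m n * Phi_kernel \<tau> M m' n * of_real (Delta \<tau> M n)) \<and>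
            (\<Sum>n=0..M. Phi_kernel \<tau> M m n * Phi_kernel \<tau> M m' n * of_real (Delta \<tau> M n)) =
              (if m \<noteq> m' then 0 else of_real (inverse (Delta_hat \<tau> M m))))) \<and>
         (orthogonal_basis M (Delta_hat \<tau> M) (\<lambda>n. (\<lambda>m. Phi_kernel \<tau> M m n)) \<and>
         (\<forall>n\<in>Lam M. \<forall>n'\<in>Lam M.
            inner_l2 M (Delta_hat \<tau> M) (\<lambda>m. Phi_kernel \<tau> M m n) (\<lambda>m. Phi_kernel \<tau> M m n') =
              (\<Sum>m=0..M. Phi_kernel \<tau> M m n * Phi_kernel \<tau> M m n' * of_real (Delta_hat \<tau> M m)) \<and>
            (\<Sum>m=0..M. Phi_kernel \<tau> M m n * Phi_kernel \<tau> M m n' * of_real (Delta_hat \<tau> M m)) =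
              (if n \<noteq> n' then 0 else of_real (inverse (Delta \<tau> M n)))))"
proof -
  note K = Phi_kernel_eq_spherical[OF assms]
  have cnj: "cnj (Phi_kernel \<tau> M m n) = Phi_kernel \<tau> M m n" for m n
    by (cases "m \<in> Lam M \<and> n \<in> Lam M") (simp add: K, auto simp: Phi_kernel_def)
  have inner: "inner_l2 M w (\<lambda>n. Phi_kernel \<tau> M m n) (\<lambda>n. Phi_kernel \<tau> M m' n) =
      (\<Sum>n=0..M. Phi_kernel \<tau> M m n * Phi_kernel \<tau> M m' n * of_real (w n))"
    and inner': "inner_l2 M w (\<lambda>m. Phi_kernel \<tau> M m n) (\<lambda>m. Phi_kernel \<tau> M m n') =
      (\<Sum>m=0..M. Phi_kernel \<tau> M m n * Phi_kernel \<tau> M m n' * of_real (w m))" for w m m' n n'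
    unfolding inner_l2_def cnj by (rule refl)+
  have mem: "(\<lambda>n. Phi_kernel \<tau> M m n) \<in> Lam_functions M"
    "(\<lambda>m. Phi_kernel \<tau> M m n) \<in> Lam_functions M" for m n
    by (auto simp: Lam_functions_def Phi_kernel_def)
  have rows: "(\<Sum>n=0..M. Phi_kernel \<tau> M m n * Phi_kernel \<tau> M m' n * of_real (Delta \<tau> M n)) =
      (if m = m' then of_real (inverse (Delta_hat \<tau> M m)) else 0)"
    if "m \<in> Lam M" "m' \<in> Lam M" for m m'
  proof -
    have "(\<Sum>n=0..M. Phi_kernel \<tau> M m n * Phi_kernel \<tau> M m' n * of_real (Delta \<tau> M n)) =
        of_real (\<Sum>n\<in>Lam M. spherical \<tau> (xi \<tau> M m) n * spherical \<tau> (xi \<tau> M m') n * Delta \<tau> M n)"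
      using that by (simp add: K cong: sum.cong_simp)
    then show ?thesis
      unfolding spherical_orthogonality[OF assms that] by simp
  qed
  have hat: "Delta_hat \<tau> M m \<noteq> 0" if "m \<in> Lam M" for m
    using Delta_hat_pos[OF assms that] by simp
  have Delta: "Delta \<tau> M n \<noteq> 0" for n
    using add_pos_nonneg[OF zero_less_one zero_le_power2[of \<tau>]] by (simp add: Delta_def)
  have row_basis: "orthogonal_basis M (Delta \<tau> M) (\<lambda>m. (\<lambda>n. Phi_kernel \<tau> M m n))"
    by (rule orthogonal_basisI[OF mem(1), where N = "\<lambda>m. of_real (inverse (Delta_hat \<tau> M m))"])
      (simp_all add: inner rows hat)
  \<comment> \<open>The rows have squared norm 1/\<open>Delta_hat\<close>, so the expansion of
    indicators yields column sums weighted by \<open>Delta_hat\<close>.\<close>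
  have columns: "(\<Sum>m=0..M. Phi_kernel \<tau> M m n * Phi_kernel \<tau> M m n' * of_real (Delta_hat \<tau> M m)) =
      (if n = n' then of_real (inverse (Delta \<tau> M n)) else 0)"
    if "n \<in> Lam M" "n' \<in> Lam M" for n n'
    using orthogonal_basis_dual[OF row_basis _ _ that Delta,
        where N = "\<lambda>m. of_real (Delta_hat \<tau> M m)"]
    by (simp add: inner rows hat cnj)
  \<comment> \<open>The column relations have the shape required by the basis criterion, now with
    squared norms 1/\<open>Delta\<close>.\<close>
  have column_basis: "orthogonal_basis M (Delta_hat \<tau> M) (\<lambda>n. (\<lambda>m. Phi_kernel \<tau> M m n))"
    by (rule orthogonal_basisI[OF mem(2), where N = "\<lambda>n. of_real (inverse (Delta \<tau> M n))"])
      (simp_all add: inner' columns Delta)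
  have real: "Phi_kernel \<tau> M m n \<in> \<real>" for m n
    using cnj by (simp add: Reals_cnj_iff)
  show ?thesis
    using row_basis column_basis real by (simp add: inner inner' rows columns del: of_real_inverse)
qed

end
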